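(* Let $\rho,\sigma>0$, $s_1<s_2$, and let $c,\tilde c,\lambda,\tilde\lambda$ satisfy $c\ge\tilde c\ge0$, $\lambda\ge\tilde\lambda\ge0$, $(c,\lambda)\ne(\tilde c,\tilde\lambda)$ and $1-\lambda\rho>0$. With $\varphi_1=\varphi_1^{A_{11},A_{12}}$ and $\varphi_2=\varphi_2^{A_{21},A_{22}}$ as in the context, there exists a family of (infinitely many) 8-uples $(A_{11},A_{12},A_{21},A_{22},\bar x_1,\bar x_2,x_1^*,x_2^* )$ of real numbers satisfying the order conditions $$\bar x_1<x_1^*<\bar x_2,\qquad \bar x_1<x_2^*<\bar x_2,$$ and the conditions $$\begin{cases}\varphi_1'(x_1^* )=\lambda\ \text{ and }\ \varphi_1''(x_1^* )\le0,\\ \varphi_1'(\bar x_1)=\lambda,\\ \varphi_1(\bar x_1)=\varphi_1(x_1^* )-c-\lambda(x_1^*-\bar x_1),\\ \varphi_1(\bar x_2)=\varphi_1(x_2^* )+\tilde c+\tilde\lambda(\bar x_2-x_2^* ),\end{cases}\qquad \begin{cases}\varphi_2'(x_2^* )=-\lambda\ \text{ and }\ \varphi_2''(x_2^* )\le0,\\ \varphi_2'(\bar x_2)=-\lambda,\\ \varphi_2(\bar x_1)=\varphi_2(x_1^* )+\tilde c+\tilde\lambda(x_1^*-\bar x_1),\\ \varphi_2(\bar x_2)=\varphi_2(x_2^* )-c-\lambda(\bar x_2-x_2^* ).\end{cases}$$ Moreover, for each of such 8-uples there exists $\tilde x\in\,]x_2^*,\bar x_2[$ such that $\varphi_2''<0$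 in $]\bar x_1,\tilde x[$ and $\varphi_2''>0$ in $]\tilde x,\bar x_2[$.
   Context: For real numbers $A_{ij}$ and $\theta=\sqrt{2\rho/\sigma^2}$, define for $x\in\mathbb{R}$ $$\varphi_1^{A_{11},A_{12}}(x)=A_{11}e^{\theta x}+A_{12}e^{-\theta x}+\frac{x-s_1}{\rho},\qquad \varphi_2^{A_{21},A_{22}}(x)=A_{21}e^{\theta x}+A_{22}e^{-\theta x}+\frac{s_2-x}{\rho}.$$
   Formalization: The formal statement adds the hypothesis c > 0: when c = c̃ = 0 (and λ > λ̃) no 8-uple exists, since φ₁(x) − λx would have three critical points by Rolle's theorem, while its derivative has at most two zeros. *)

theory Defs
  imports "HOL-Analysis.Analysis"
begin

definition theta :: "real \<Rightarrow> real \<Rightarrow> real" where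
  "theta \<rho> \<sigma> = sqrt (2 * \<rho> / \<sigma>\<^sup>2)"

definition phi1 :: "real \<Rightarrow> real \<Rightarrow> real \<Rightarrow> real \<Rightarrow> real \<Rightarrow> real \<Rightarrow> real" where
  "phi1 \<rho> \<sigma> s1 A11 A12 x =
     A11 * exp (theta \<rho> \<sigma> * x) + A12 * exp (- theta \<rho> \<sigma> * x) + (x - s1) / \<rho>"

definition phi2 :: "real \<Rightarrow> real \<Rightarrow> real \<Rightarrow> real \<Rightarrow> real \<Rightarrow> real \<Rightarrow> real" where
  "phi2 \<rho> \<sigma> s2 A21 A22 x =
     A21 * exp (theta \<rho> \<sigma> * x) + A22 * exp (- theta \<rho> \<sigma> * x) + (s2 - x) / \<rho>"

type_synonym octuple = "real \<times> real \<times> real \<times> real \<times> real \<times> real \<times> real \<times> real"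

(* ct and lt stand for the costs written c and lambda with a tilde (l is lambda).  In the
   8-uples, b1 < b2 are the points written x_1 and x_2 with a bar, and p1, p2 are x_1^*, x_2^*. *)
definition solutions ::
  "real \<Rightarrow> real \<Rightarrow> real \<Rightarrow> real \<Rightarrow> real \<Rightarrow> real \<Rightarrow> real \<Rightarrow> real \<Rightarrow> octuple set" where
  "solutions \<rho> \<sigma> s1 s2 c ct l lt =
     {(A11, A12, A21, A22, b1, b2, p1, p2).
       let f1 = phi1 \<rho> \<sigma> s1 A11 A12; f2 = phi2 \<rho> \<sigma> s2 A21 A22 in
         b1 < p1 \<and> p1 < b2 \<and> b1 < p2 \<and> p2 < b2 \<and>
         deriv f1 p1 = l \<and> deriv (deriv f1) p1 \<le> 0 \<and>
         deriv f1 b1 = l \<and>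
         f1 b1 = f1 p1 - c - l * (p1 - b1) \<and>
         f1 b2 = f1 p2 + ct + lt * (b2 - p2) \<and>
         deriv f2 p2 = - l \<and> deriv (deriv f2) p2 \<le> 0 \<and>
         deriv f2 b2 = - l \<and>
         f2 b1 = f2 p1 + ct + lt * (p1 - b1) \<and>
         f2 b2 = f2 p2 - c - l * (b2 - p2)}"

lemma deriv_phi1:
  "(phi1 \<rho> \<sigma> s1 A B has_real_derivative
     theta \<rho> \<sigma> * A * exp (theta \<rho> \<sigma> * x) - theta \<rho> \<sigma> * B * exp (- theta \<rho> \<sigma> * x) + 1 / \<rho>) (at x)"
  unfolding phi1_def[abs_def] divide_inverse
  by (auto intro!: derivative_eq_intros)

(* For c = 0 the conditions are contradictory: x |-> phi1 x - l * x would have equal values and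
   vanishing derivative at b1 and p1, hence three critical points.  So existence needs c > 0. *)
lemma solutions_no_fixed_cost:
  assumes "\<rho> > 0" "\<sigma> > 0" "1 - l * \<rho> > 0"
  shows "solutions \<rho> \<sigma> s1 s2 0 ct l lt = {}"
proof (rule ccontr)
  assume "\<not> ?thesis"
  then obtain A B b p where bp: "b < p"
    and d1: "deriv (phi1 \<rho> \<sigma> s1 A B) p = l" and d2: "deriv (phi1 \<rho> \<sigma> s1 A B) b = l"
    and e: "phi1 \<rho> \<sigma> s1 A B b = phi1 \<rho> \<sigma> s1 A B p - l * (p - b)"
    by (fastforce simp: solutions_def Let_def)
  define t where "t = theta \<rho> \<sigma>"
  have t: "t > 0" using assms by (simp add: t_def theta_def)
  define k where "k = 1 / \<rho> - l"
  have k: "k > 0" using assms by (simp add: k_def field_simps)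
  define f where "f x = phi1 \<rho> \<sigma> s1 A B x - l * x" for x
  define g where "g x = t * A * exp (t * x) - t * B * exp (- t * x) + k" for x
  have g: "(f has_real_derivative g x) (at x)" for x
    unfolding f_def[abs_def] g_def k_def t_def
    by (auto intro!: derivative_eq_intros deriv_phi1)
  have dphi: "deriv (phi1 \<rho> \<sigma> s1 A B) x = g x + l" for x
    unfolding g_def k_def t_def by (rule DERIV_imp_deriv[THEN trans, OF deriv_phi1]) simp
  have gp: "g p = 0" and gb: "g b = 0" using d1 d2 by (auto simp: dphi)
  have "\<exists>m>b. m < p \<and> f p - f b = (p - b) * g m"
    by (rule MVT2) (use bp g in auto)
  moreover have "f p - f b = 0" using e by (simp add: f_def algebra_simps)
  ultimately obtain m where m: "b < m" "m < p" and gm: "g m = 0" using bp by auto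
  define Y where "Y x = exp (t * x)" for x
  have Y: "Y x > 0" for x by (simp add: Y_def)
  have q: "t * A * (Y x)\<^sup>2 + k * Y x = t * B" if "g x = 0" for x
  proof -
    have "exp (- t * x) * Y x = 1" by (simp add: Y_def flip: exp_add)
    moreover have "g x * Y x = t * A * (Y x)\<^sup>2 - t * B * (exp (- t * x) * Y x) + k * Y x"
      unfolding g_def by (simp add: Y_def algebra_simps power2_eq_square)
    ultimately show ?thesis using that by simp
  qed
  have lt: "Y b < Y m" "Y m < Y p" using m t by (auto simp: Y_def)
  have s: "t * A * (Y x + Y y) + k = 0" if "g x = 0" "g y = 0" "Y x < Y y" for x y
  proof -
    have "(t * A * (Y x + Y y) + k) * (Y y - Y x) = 0"
      using q[OF that(1)] q[OF that(2)] by (simp add: algebra_simps power2_eq_square)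
    then show ?thesis using that(3) by simp
  qed
  have "t * A * (Y p - Y b) = (t * A * (Y m + Y p) + k) - (t * A * (Y b + Y m) + k)"
    by (simp add: algebra_simps)
  also have "\<dots> = 0"
    using s[OF gb gm lt(1)] s[OF gm gp lt(2)] by simp
  finally have "t * A * (Y p - Y b) = 0" .
  then have "A = 0" using lt t by simp
  then show False using s[OF gb gm lt(1)] k by simp
qed

end

theory Submission
  imports Defs
begin

text \<open>
  Only differences of values and derivatives of \<open>\<phi>\<^sub>1\<close> and \<open>\<phi>\<^sub>2\<close> enter the conditions, so these are
  invariant under translating all points, and under the reflection that exchanges the two
  functions. Translation turns one solution into infinitely many, and reflection suggests looking
  for a solution in which \<open>\<phi>\<^sub>2\<close> is the mirror image of \<open>\<phi>\<^sub>1\<close>.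

  A function \<open>\<phi>\<close> of the given form whose derivative takes the same value at two distinct points
  must be a linear function plus a multiple of \<open>sinh (\<theta> (x - m))\<close>, where \<open>m\<close> is the midpoint of the
  two points (\<open>phi2_eq_sinh_profile\<close>). Since \<open>\<phi>\<^sub>2'\<close> equals \<open>-\<lambda>\<close> at \<open>x\<^sub>2\<^sup>*\<close> and at the right
  threshold, and \<open>\<lambda> < 1 / \<rho>\<close> makes the multiple positive, \<open>\<phi>\<^sub>2''\<close> changes from negative to
  positive at their midpoint and nowhere else.

  For existence, let \<open>\<phi>\<^sub>1\<close> be such a profile with centre \<open>z - n\<close> and \<open>\<phi>\<^sub>2\<close> one with centre \<open>z + n\<close>,
  and let the four points be those at distance \<open>\<delta>\<close> from the two centres. For \<open>n > 0\<close> they satisfy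
  the order conditions. The conditions on the derivatives fix the
  amplitude of both profiles, and two equations remain. The equation with \<open>c\<close> reads
  \<open>2 k (\<delta> - tanh (\<theta> \<delta>) / \<theta>) = c\<close> with \<open>k = 1 / \<rho> - \<lambda> > 0\<close>; it involves \<open>\<delta>\<close> alone and is solvable for
  every \<open>c > 0\<close> (\<open>half_length_exists\<close>). The other one prescribes \<open>cosh (2 \<theta> n)\<close>, and the prescribed
  number exceeds \<open>1\<close> exactly when \<open>c + 2 \<lambda> \<delta>\<close> exceeds the same expression in the costs with a
  tilde, which is where \<open>(c, \<lambda>) \<noteq> (ct, lt)\<close> enters. The centre \<open>z\<close> remains free.
\<close>

definition sinh_profile :: "real \<Rightarrow> real \<Rightarrow> real \<Rightarrow> real \<Rightarrow> real \<Rightarrow> real \<Rightarrow> real" where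
  "sinh_profile a e K t m x = a * (x - e) + K * sinh (t * (x - m))"

lemma deriv_sinh_profile:
  "deriv (sinh_profile a e K t m) = (\<lambda>x. a + K * t * cosh (t * (x - m)))"
proof
  fix x
  show "deriv (sinh_profile a e K t m) x = a + K * t * cosh (t * (x - m))"
    unfolding sinh_profile_def[abs_def]
    by (rule DERIV_imp_deriv) (auto intro!: derivative_eq_intros)
qed

lemma deriv_deriv_sinh_profile:
  "deriv (deriv (sinh_profile a e K t m)) x = K * t\<^sup>2 * sinh (t * (x - m))"
  unfolding deriv_sinh_profile
  by (rule DERIV_imp_deriv) (auto intro!: derivative_eq_intros simp: power2_eq_square)

lemma phi1_sinh_profile:
  "phi1 \<rho> \<sigma> s1 (- K / 2 * exp (- theta \<rho> \<sigma> * m)) (K / 2 * exp (theta \<rho> \<sigma> * m))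
     = sinh_profile (1 / \<rho>) s1 (- K) (theta \<rho> \<sigma>) m"
  by (auto simp: fun_eq_iff phi1_def sinh_profile_def sinh_field_def algebra_simps
      diff_divide_distrib simp flip: exp_add)

lemma phi2_sinh_profile:
  "phi2 \<rho> \<sigma> s2 (K / 2 * exp (- theta \<rho> \<sigma> * m)) (- K / 2 * exp (theta \<rho> \<sigma> * m))
     = sinh_profile (- 1 / \<rho>) s2 K (theta \<rho> \<sigma>) m"
  by (auto simp: fun_eq_iff phi2_def sinh_profile_def sinh_field_def algebra_simps
      diff_divide_distrib simp flip: exp_add)

lemma deriv_phi2:
  "deriv (phi2 \<rho> \<sigma> s2 A B) x =
     theta \<rho> \<sigma> * A * exp (theta \<rho> \<sigma> * x) - theta \<rho> \<sigma> * B * exp (- theta \<rho> \<sigma> * x) - 1 / \<rho>"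
  unfolding phi2_def[abs_def] divide_inverse
  by (rule DERIV_imp_deriv) (auto intro!: derivative_eq_intros)

lemma theta_pos: "\<rho> > 0 \<Longrightarrow> \<sigma> > 0 \<Longrightarrow> theta \<rho> \<sigma> > 0"
  by (simp add: theta_def)

text \<open>
  In terms of \<open>y = exp (\<theta> x)\<close> the derivative is, up to a constant, \<open>\<theta> (A y - B / y)\<close>. This takes the
  same value at \<open>y \<noteq> y'\<close> only if \<open>A y y' = - B\<close>, which makes it a multiple of the hyperbolic cosine
  centred at the midpoint.
\<close>

lemma phi2_eq_sinh_profile:
  assumes "\<rho> > 0" "\<sigma> > 0" "p < b"
    and eq: "deriv (phi2 \<rho> \<sigma> s2 A B) p = deriv (phi2 \<rho> \<sigma> s2 A B) b"
  obtains K where "phi2 \<rho> \<sigma> s2 A B = sinh_profile (- 1 / \<rho>) s2 K (theta \<rho> \<sigma>) ((p + b) / 2)"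
proof -
  define t where "t = theta \<rho> \<sigma>"
  have t: "t > 0" using assms theta_pos by (simp add: t_def)
  define m where "m = (p + b) / 2"
  define y where "y = exp (t * p)"
  define w where "w = exp (t * b)"
  have yw: "y > 0" "w > y" using t \<open>p < b\<close> by (auto simp: y_def w_def)
  have "t * (A * y - B / y) = t * (A * w - B / w)"
    using eq unfolding deriv_phi2
    by (simp add: y_def w_def exp_minus divide_inverse algebra_simps flip: t_def)
  then have "A * y - B / y = A * w - B / w" using t by simp
  then have "(A * (y * w) + B) * (w - y) = 0" using yw by (simp add: field_simps)
  then have "B = - A * (y * w)" using yw by simp
  also have "y * w = exp (t * m) * exp (t * m)"
    by (simp add: y_def w_def m_def algebra_simps flip: exp_add)
  finally have "B = - (2 * A * exp (t * m)) / 2 * exp (t * m)" by simp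
  moreover have "A = (2 * A * exp (t * m)) / 2 * exp (- t * m)"
    by (simp add: exp_minus)
  ultimately have "phi2 \<rho> \<sigma> s2 A B = sinh_profile (- 1 / \<rho>) s2 (2 * A * exp (t * m)) t m"
    using phi2_sinh_profile[of \<rho> \<sigma> s2 "2 * A * exp (t * m)" m] unfolding t_def by metis
  then show ?thesis using that unfolding t_def m_def by blast
qed

lemma phi2_concave_convex:
  assumes "\<rho> > 0" "\<sigma> > 0" "1 - l * \<rho> > 0" "p < b"
    and dp: "deriv (phi2 \<rho> \<sigma> s2 A B) p = - l" and db: "deriv (phi2 \<rho> \<sigma> s2 A B) b = - l"
  shows "x < (p + b) / 2 \<Longrightarrow> deriv (deriv (phi2 \<rho> \<sigma> s2 A B)) x < 0"
    and "x > (p + b) / 2 \<Longrightarrow> deriv (deriv (phi2 \<rho> \<sigma> s2 A B)) x > 0"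
proof -
  define t where "t = theta \<rho> \<sigma>"
  have t: "t > 0" using assms theta_pos by (simp add: t_def)
  define m where "m = (p + b) / 2"
  obtain K where phi: "phi2 \<rho> \<sigma> s2 A B = sinh_profile (- 1 / \<rho>) s2 K t m"
    using phi2_eq_sinh_profile[of \<rho> \<sigma> p b s2 A B] assms unfolding t_def m_def by metis
  have "K * (t * cosh (t * (p - m))) = 1 / \<rho> - l"
    using dp unfolding phi deriv_sinh_profile by (simp add: algebra_simps)
  also have "\<dots> > 0" using assms by (simp add: field_simps)
  finally have K: "K > 0"
    using t by (simp add: zero_less_mult_iff)
      (smt (verit) cosh_real_pos mult_nonneg_nonneg)
  show "deriv (deriv (phi2 \<rho> \<sigma> s2 A B)) x < 0" if "x < (p + b) / 2"
  proof -
    have "t * (x - m) < 0" using t that by (simp add: m_def mult_pos_neg)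
    then show ?thesis
      using K t by (simp add: phi deriv_deriv_sinh_profile mult_pos_neg)
  qed
  show "deriv (deriv (phi2 \<rho> \<sigma> s2 A B)) x > 0" if "x > (p + b) / 2"
    using K t that by (simp add: phi deriv_deriv_sinh_profile m_def)
qed

text \<open>
  The expression vanishes at \<open>d = 0\<close> and, since \<open>tanh < 1\<close>, exceeds \<open>2 * k * (d - 1 / t)\<close>, so the
  intermediate value theorem applies.
\<close>

lemma half_length_exists:
  fixes k t c :: real
  assumes "k > 0" "t > 0" "c > 0"
  obtains d where "d > 0" "2 * k * (d - tanh (t * d) / t) = c"
proof -
  define f where "f d = 2 * k * (d - tanh (t * d) / t)" for d
  define u where "u = c / (2 * k) + 1 / t"
  have "u - tanh (t * u) / t \<ge> c / (2 * k)"
    using tanh_real_lt_1[of "t * u"] assms by (simp add: u_def divide_right_mono)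
  then have "c \<le> f u" using assms by (simp add: f_def field_simps)
  moreover have "f 0 \<le> c" using assms by (simp add: f_def)
  moreover have "0 \<le> u" using assms by (simp add: u_def)
  moreover have "continuous_on {0..u} f"
    unfolding f_def[abs_def] using assms by (intro continuous_intros) auto
  ultimately obtain d where d: "0 \<le> d" "f d = c" using IVT'[of f 0 c u] by blast
  then have "d \<noteq> 0" using assms by (auto simp: f_def)
  then show ?thesis using d that[of d] by (auto simp: f_def)
qed

lemma sinh_diff_centred: "sinh (a + b) - sinh (a - b) = 2 * cosh a * sinh (b :: real)"
  by (simp add: sinh_add sinh_diff)

text \<open>
  The amplitude \<open>K\<close> is the one for which \<open>\<phi>\<^sub>1'\<close> equals \<open>\<lambda>\<close> at distance \<open>d\<close> from the centre, and
  then by symmetry \<open>\<phi>\<^sub>2'\<close> equals \<open>-\<lambda>\<close> at that distance from its own centre.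
\<close>

lemma symmetric_solutions:
  assumes pos: "\<rho> > 0" "\<sigma> > 0" "c > 0" "1 - l * \<rho> > 0"
    and le: "ct \<le> c" "lt \<le> l" "(c, l) \<noteq> (ct, lt)"
  obtains K n d where "\<And>z. let t = theta \<rho> \<sigma> in
    (- K / 2 * exp (- t * (z - n)), K / 2 * exp (t * (z - n)),
     K / 2 * exp (- t * (z + n)), - K / 2 * exp (t * (z + n)),
     z - n - d, z + n + d, z - n + d, z + n - d) \<in> solutions \<rho> \<sigma> s1 s2 c ct l lt"
proof -
  define t where "t = theta \<rho> \<sigma>"
  have t: "t > 0" using pos theta_pos by (simp add: t_def)
  define k where "k = 1 / \<rho> - l"
  have k: "k > 0" using pos by (simp add: k_def field_simps)
  obtain d where d: "d > 0" and d_eq: "2 * k * (d - tanh (t * d) / t) = c"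
    using half_length_exists k t pos by metis
  define K where "K = k / (t * cosh (t * d))"
  define S where "S = 2 * K * sinh (t * d)"
  have K: "K > 0" using k t by (simp add: K_def)
  have Kc: "K * t * cosh (t * d) = k" using t by (simp add: K_def)
  have S: "S > 0" using K t d by (simp add: S_def)
  have "S = 2 * k * tanh (t * d) / t" by (simp add: S_def K_def tanh_def)
  then have "2 * k * d - S = c" using d_eq by (simp add: right_diff_distrib)
  then have S_eq: "S = 2 * d / \<rho> - c - 2 * l * d" by (simp add: k_def algebra_simps)
  define R where "R = 2 * d / \<rho> - ct - 2 * lt * d"
  have "ct + lt * (2 * d) < c + l * (2 * d)"
  proof (cases "l = lt")
    case True
    then show ?thesis using le by simp
  next
    case False
    then have "lt * (2 * d) < l * (2 * d)" using le d by simp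
    then show ?thesis using le by simp
  qed
  then have "S < R" by (simp add: S_eq R_def algebra_simps)
  \<comment> \<open>Between the two points around the centre of one profile, the other one increases or decreases
    by \<open>2 * d / \<rho> - S * cosh (2 * t * n)\<close>, which has to be \<open>ct + lt * (2 * d)\<close>.\<close>
  define n where "n = arcosh (R / S) / (2 * t)"
  have RS: "R / S > 1" using \<open>S < R\<close> S by simp
  then have "arcosh (R / S) > 0" by (subst arcosh_real_gt_1_iff) linarith+
  then have n: "n > 0" using t by (simp add: n_def)
  have "cosh (t * (2 * n)) = R / S" using RS t by (simp add: n_def)
  then have ch: "S * cosh (t * (2 * n)) = R" using S by simp
  have far: "K * sinh (t * (2 * n + d)) - K * sinh (t * (2 * n - d)) = R"
    using sinh_diff_centred[of "t * (2 * n)" "t * d"] ch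
    by (simp add: S_def algebra_simps flip: right_diff_distrib)
  have flip: "sinh (t * (- x)) = - sinh (t * x)" "cosh (t * (- x)) = cosh (t * x)" for x
    by simp_all
  have "(- K / 2 * exp (- t * (z - n)), K / 2 * exp (t * (z - n)),
     K / 2 * exp (- t * (z + n)), - K / 2 * exp (t * (z + n)),
     z - n - d, z + n + d, z - n + d, z + n - d) \<in> solutions \<rho> \<sigma> s1 s2 c ct l lt" for z
  proof -
    have points: "z - n - d - (z - n) = - d" "z - n + d - (z - n) = d"
      "z + n + d - (z - n) = 2 * n + d" "z + n - d - (z - n) = 2 * n - d"
      "z - n - d - (z + n) = - (2 * n + d)" "z - n + d - (z + n) = - (2 * n - d)"
      "z + n + d - (z + n) = d" "z + n - d - (z + n) = - d"
      by simp_all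
    have "sinh_profile (1 / \<rho>) s1 (- K) t (z - n) (z - n - d)
        = sinh_profile (1 / \<rho>) s1 (- K) t (z - n) (z - n + d) - c - l * (2 * d)"
      unfolding sinh_profile_def points flip using S_eq
      by (simp add: S_def algebra_simps diff_divide_distrib add_divide_distrib)
    moreover have "sinh_profile (1 / \<rho>) s1 (- K) t (z - n) (z + n + d)
        = sinh_profile (1 / \<rho>) s1 (- K) t (z - n) (z + n - d) + ct + lt * (2 * d)"
      unfolding sinh_profile_def points using far
      by (simp add: R_def algebra_simps diff_divide_distrib add_divide_distrib)
    moreover have "sinh_profile (- 1 / \<rho>) s2 K t (z + n) (z - n - d)
        = sinh_profile (- 1 / \<rho>) s2 K t (z + n) (z - n + d) + ct + lt * (2 * d)"
      unfolding sinh_profile_def points flip using far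
      by (simp add: R_def algebra_simps diff_divide_distrib add_divide_distrib)
    moreover have "sinh_profile (- 1 / \<rho>) s2 K t (z + n) (z + n + d)
        = sinh_profile (- 1 / \<rho>) s2 K t (z + n) (z + n - d) - c - l * (2 * d)"
      unfolding sinh_profile_def points flip using S_eq
      by (simp add: S_def algebra_simps diff_divide_distrib add_divide_distrib)
    moreover have "deriv (deriv (sinh_profile (1 / \<rho>) s1 (- K) t (z - n))) (z - n + d) \<le> 0"
      unfolding deriv_deriv_sinh_profile points using K t d by simp
    moreover have "deriv (deriv (sinh_profile (- 1 / \<rho>) s2 K t (z + n))) (z + n - d) \<le> 0"
      unfolding deriv_deriv_sinh_profile points flip using K t d by simp
    moreover have "z - n + d - (z - n - d) = 2 * d" "z + n + d - (z + n - d) = 2 * d"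
      by simp_all
    ultimately show ?thesis
      using n d K t Kc
      unfolding solutions_def Let_def t_def
      unfolding mem_Collect_eq prod.case phi1_sinh_profile phi2_sinh_profile
        deriv_deriv_sinh_profile deriv_sinh_profile points
      by (simp add: k_def)
  qed
  then show ?thesis using that unfolding Let_def t_def by blast
qed

theorem proposition4p2:
  fixes \<rho> \<sigma> s1 s2 c ct l lt :: real
  assumes "\<rho> > 0" and "\<sigma> > 0" and "s1 < s2"
    and "c \<ge> ct" and "ct \<ge> 0"
    and "l \<ge> lt" and "lt \<ge> 0"
    and "(c, l) \<noteq> (ct, lt)"
    and "1 - l * \<rho> > 0"
    and "c > 0"
  shows "infinite (solutions \<rho> \<sigma> s1 s2 c ct l lt) \<and>
    (\<forall>(A11, A12, A21, A22, b1, b2, p1, p2) \<in> solutions \<rho> \<sigma> s1 s2 c ct l lt.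
      \<exists>xt. p2 < xt \<and> xt < b2 \<and>
        (\<forall>x\<in>{b1<..<xt}. deriv (deriv (phi2 \<rho> \<sigma> s2 A21 A22)) x < 0) \<and>
        (\<forall>x\<in>{xt<..<b2}. deriv (deriv (phi2 \<rho> \<sigma> s2 A21 A22)) x > 0))"
proof (intro conjI ballI)
  obtain K n d where sol: "\<And>z. let t = theta \<rho> \<sigma> in
    (- K / 2 * exp (- t * (z - n)), K / 2 * exp (t * (z - n)),
     K / 2 * exp (- t * (z + n)), - K / 2 * exp (t * (z + n)),
     z - n - d, z + n + d, z - n + d, z + n - d) \<in> solutions \<rho> \<sigma> s1 s2 c ct l lt"
    using symmetric_solutions[of \<rho> \<sigma> c l ct lt s1 s2] assms by blast
  \<comment> \<open>Choosing the centre puts the leftmost point at any prescribed real number.\<close>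
  define b1_of :: "octuple \<Rightarrow> real" where "b1_of = (\<lambda>(_, _, _, _, b1, _). b1)"
  have "x \<in> b1_of ` solutions \<rho> \<sigma> s1 s2 c ct l lt" for x
    using sol[of "x + n + d"] by (force simp: b1_of_def Let_def intro: rev_image_eqI)
  then have "b1_of ` solutions \<rho> \<sigma> s1 s2 c ct l lt = UNIV" by blast
  then show "infinite (solutions \<rho> \<sigma> s1 s2 c ct l lt)"
    using infinite_UNIV_char_0[where 'a = real] finite_imageI by metis
next
  fix u assume u: "u \<in> solutions \<rho> \<sigma> s1 s2 c ct l lt"
  obtain A11 A12 A21 A22 b1 b2 p1 p2 where u_eq: "u = (A11, A12, A21, A22, b1, b2, p1, p2)"
    by (metis surj_pair)
  have p2: "p2 < b2" "deriv (phi2 \<rho> \<sigma> s2 A21 A22) p2 = - l" "deriv (phi2 \<rho> \<sigma> s2 A21 A22) b2 = - l"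
    using u by (auto simp: u_eq solutions_def Let_def)
  show "case u of (A11, A12, A21, A22, b1, b2, p1, p2) \<Rightarrow> \<exists>xt. p2 < xt \<and> xt < b2 \<and>
        (\<forall>x\<in>{b1<..<xt}. deriv (deriv (phi2 \<rho> \<sigma> s2 A21 A22)) x < 0) \<and>
        (\<forall>x\<in>{xt<..<b2}. deriv (deriv (phi2 \<rho> \<sigma> s2 A21 A22)) x > 0)"
    unfolding u_eq prod.case
    using phi2_concave_convex[OF assms(1,2,9) p2] p2(1)
    by (intro exI[of _ "(p2 + b2) / 2"]) auto
qed

end
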